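(* Let $N=|X\setminus A|$. For every $t>0$ and every $f\in\mathcal H_t$, $$\mathrm{Lip}(f)\;\le\;\|f\|_{\mathcal H_t}\left(\int_{\mathbb T^{N}}\mathrm{Lip}(\phi_\theta)^2\,\exp\!\left(-t\,\frac{4w_{\min}d_{\min}^2}{\pi^2}\,\mathrm{Lip}(\phi_\theta)^2\right)d\mu(\theta)\right)^{1/2}.$$
   Context: Lipschitz seminorm: for a map $f:(M_1,\rho_1)\to(M_2,\rho_2)$ of metric spaces, $\mathrm{Lip}(f):=\sup_{\alpha\ne\beta}\rho_2(f(\alpha),f(\beta))/\rho_1(\alpha,\beta)\in[0,\infty]$. Setting: $(X,d)$ is a metric space and $A\subseteq X$ is nonempty with $X\setminus A=\{x_1,\dots,x_N\}$ finite, $N\ge1$. Write $d(x,A)=\inf_{a\in A}d(x,a)$ and $d_1(x,y):=\min\{d(x,y),\,d(x,A)+d(y,A)\}$. Let $X/A=\{[A],x_1,\dots,x_N\}$ be the quotient collapsing $A$ to the basepoint $[A]$, and let $\overline d_1$ be the function on $X/A$ induced by $d_1$; it is assumed to be a metric on $X/A$ (equivalently $d(x_j,A)>0$ for all $j$). Diagrams: $D(X,A)$ is the free commutative monoid on $X\setminus A$ (finite multisets of points of $X\setminus A$; the point $[A]$ is identified with $0$). For $\alpha,\beta\in D(X,A)$, $W_1(\alpha,\beta)$ is the infimum of $\sum_{i}\overline d_1(u_i,v_i)$ over all finite multisets $\{(u_i,v_i)\}_i$ of pairs in $(X/A)\times(X/A)$ such that $\sum_i u_i$ equals $\alpha$ and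 $\sum_i v_i$ equals $\beta$ modulo multiples of $[A]$. $K(X,A)$ is the Grothendieck group of $D(X,A)$, identified with the free abelian group $\mathbb Z^{N}$ with basis $e_1,\dots,e_N$, where $e_j$ is the class of $x_j$. It carries the translation-invariant metric $\rho(a-b,c-e):=W_1(a+e,c+b)$ for $a,b,c,e\in D(X,A)$. Characters and phases: $\mathbb T^{N}=\mathbb R^{N}/2\pi\mathbb Z^{N}$ with normalized Haar (Lebesgue) probability measure $\mu$. For $\theta\in\mathbb T^N$, $\chi_\theta:K(X,A)\to S^1\subset\mathbb C$ is $\chi_\theta(\sum_j n_je_j)=\exp(i\sum_j n_j\theta_j)$. The phase function $\phi_\theta:X/A\to S^1$ is $\phi_\theta([A])=1$, $\phi_\theta(x_j)=e^{i\theta_j}$. $S^1$ carries the geodesic (shorter arc length) metric $\operatorname{dist}(e^{ia},e^{ib})=\inf_{k\in\mathbb Z}|a-b+2\pi k|$. $\mathrm{Lip}(\phi_\theta)$ is taken with respect to $\overline d_1$ and $\operatorname{dist}$. Graph model: fix a connected (simple, undirected) graph $H=(V,E)$ with $V=X/A$ such that, when each edge $\{u,v\}$ is given length $\overline d_1(u,v)$, the shortest-path metric of $H$ is $\overline d_1$. Fix symmetric conductances $w_{uv}=w_{vu}>0$ for $\{u,v\}\in E$ (not necessarily equal to the lengths), with $w_{uv}=0$ if $\{u,v\}\notin E$. The Dirichlet energy is $\lambda(\theta):=\tfrac12\sum_{u,v\in V}w_{uv}|\phi_\theta(u)-\phi_\theta(v)|^2$, with $|\cdot|$ the complex modulus.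 Put $w_{\min}=\min_{\{u,v\}\in E}w_{uv}$ and $d_{\min}=\min_{\{u,v\}\in E}\overline d_1(u,v)$. Heat RKHS: for $t>0$, $\nu_t$ is the measure $d\nu_t(\theta)=e^{-t\lambda(\theta)}d\mu(\theta)$ on $\mathbb T^N$, and $k_t(\alpha,\beta)=\int_{\mathbb T^N}\chi_\theta(\alpha-\beta)\,d\nu_t(\theta)$ for $\alpha,\beta\in K(X,A)$, a positive definite kernel. $\mathcal H_t$ is the reproducing kernel Hilbert space of complex-valued functions on $K(X,A)$ with kernel $k_t$ (so $f(\alpha)=\langle f,k_t(\cdot,\alpha)\rangle_{\mathcal H_t}$). For $f\in\mathcal H_t$, $\mathrm{Lip}(f)$ is taken with respect to $\rho$ and the usual metric on $\mathbb C$. *)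

theory Defs
  imports "HOL-Probability.Probability" "HOL-Library.Multiset"
begin

text \<open>
  Conventions. The metric space \<open>X\<close> is a type of class \<open>metric_space\<close>, and the finitely many
  points \<open>x\<^sub>1, \<dots>, x\<^sub>N\<close> outside \<open>A\<close> are enumerated by an injection \<open>x :: 'n \<Rightarrow> 'a\<close> with range \<open>- A\<close>,
  where \<open>'n\<close> is a finite type, so \<open>N = CARD('n)\<close>. Accordingly

  \<^item> \<open>X/A\<close> is \<open>'n option\<close>, with \<open>None\<close> the basepoint \<open>[A]\<close> and \<open>Some j\<close> the point \<open>x j\<close>;
  \<^item> \<open>D(X,A)\<close> is \<open>'n multiset\<close>;
  \<^item> \<open>K(X,A)\<close> is \<open>int ^ 'n\<close>;
  \<^item> a point of the torus is represented by an angle vector \<open>\<theta> :: real ^ 'n\<close>.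
\<close>

section \<open>Lipschitz seminorm and arc length\<close>

definition Lip :: "('p \<Rightarrow> 'p \<Rightarrow> real) \<Rightarrow> ('q \<Rightarrow> 'q \<Rightarrow> real) \<Rightarrow> ('p \<Rightarrow> 'q) \<Rightarrow> ennreal"
  where "Lip \<rho>1 \<rho>2 f =
    (SUP (a, b) \<in> {(a, b). a \<noteq> b}. ennreal (\<rho>2 (f a) (f b) / \<rho>1 a b))"

text \<open>On a finite space \<open>Lip\<close> is finite, so \<open>enn2real\<close> applied to it loses nothing.\<close>

lemma Lip_finite:
  fixes f :: "'p::finite \<Rightarrow> 'q"
  shows "Lip \<rho>1 \<rho>2 f < \<infinity>"
proof -
  have "(SUP p\<in>S. ennreal (g p)) < \<infinity>" if "finite S" for S :: "('p \<times> 'p) set" and g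
    using that by (induction S rule: finite_induct) (auto simp: bot_ennreal sup_max)
  from this[of "{(a, b). a \<noteq> b}" "\<lambda>(a, b). \<rho>2 (f a) (f b) / \<rho>1 a b"]
  show ?thesis
    by (simp add: Lip_def case_prod_unfold)
qed

text \<open>Only meaningful on the unit circle; see \<open>arc_dist_cis\<close>.\<close>

definition arc_dist :: "complex \<Rightarrow> complex \<Rightarrow> real"
  where "arc_dist z w = (INF k::int. \<bar>Arg z - Arg w + 2 * pi * of_int k\<bar>)"

lemma arc_dist_cis: "arc_dist (cis a) (cis b) = (INF k::int. \<bar>a - b + 2 * pi * of_int k\<bar>)"
proof -
  have *: "\<exists>m::int. Arg (cis c) = c + 2 * pi * of_int m" for c
  proof -
    have "cis (Arg (cis c)) = cis c"
      by (simp add: cis_Arg sgn_eq)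
    then have "sin (Arg (cis c)) = sin c \<and> cos (Arg (cis c)) = cos c"
      by (metis cis.sel)
    then obtain m :: int where "Arg (cis c) = c + 2 * pi * of_int m"
      using sin_cos_eq_iff by blast
    then show ?thesis ..
  qed
  obtain m n :: int where mn: "Arg (cis a) = a + 2 * pi * of_int m"
      "Arg (cis b) = b + 2 * pi * of_int n"
    using *[of a] *[of b] by blast
  have "range (\<lambda>k::int. \<bar>Arg (cis a) - Arg (cis b) + 2 * pi * of_int k\<bar>) =
        range (\<lambda>k. \<bar>a - b + 2 * pi * of_int (k + (m - n))\<bar>)"
    by (simp add: mn algebra_simps)
  also have "\<dots> = (\<lambda>k::int. \<bar>a - b + 2 * pi * of_int k\<bar>) ` range (\<lambda>k. k + (m - n))"
    by (simp only: image_image)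
  also have "range (\<lambda>k::int. k + (m - n)) = UNIV"
    by (rule surjI[where f = "\<lambda>k. k - (m - n)"]) simp
  finally show ?thesis
    by (simp add: arc_dist_def)
qed

section \<open>The quotient \<open>X/A\<close>\<close>

definition d1 :: "'a::metric_space set \<Rightarrow> 'a \<Rightarrow> 'a \<Rightarrow> real"
  where "d1 A p q = min (dist p q) (infdist p A + infdist q A)"

definition repr :: "'a set \<Rightarrow> ('n \<Rightarrow> 'a) \<Rightarrow> 'n option \<Rightarrow> 'a"
  where "repr A x u = (case u of None \<Rightarrow> (SOME a. a \<in> A) | Some j \<Rightarrow> x j)"

definition d1bar :: "'a::metric_space set \<Rightarrow> ('n \<Rightarrow> 'a) \<Rightarrow> 'n option \<Rightarrow> 'n option \<Rightarrow> real"
  where "d1bar A x u v = d1 A (repr A x u) (repr A x v)"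

definition quot_map :: "'a set \<Rightarrow> ('n \<Rightarrow> 'a) \<Rightarrow> 'a \<Rightarrow> 'n option"
  where "quot_map A x p = (if p \<in> A then None else Some (THE j. x j = p))"

text \<open>\<open>d1bar\<close> does not depend on the chosen representative: it is the function induced by \<open>d1\<close>.\<close>

lemma d1bar_quot_map:
  assumes "A \<noteq> {}" "inj x" "range x = - A"
  shows "d1bar A x (quot_map A x p) (quot_map A x q) = d1 A p q"
proof -
  define a where "a = (SOME a. a \<in> A)"
  have a: "a \<in> A"
    using assms(1) unfolding a_def by (meson ex_in_conv someI)
  have rep: "repr A x (quot_map A x r) = (if r \<in> A then a else r)" for r
  proof (cases "r \<in> A")
    case False
    then have "r \<in> range x"
      using assms(3) by simp
    then obtain j where "x j = r"
      by blast
    then have "(THE j. x j = r) = j"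
      using assms(2) by (auto dest: injD)
    with False \<open>x j = r\<close> show ?thesis
      by (simp add: repr_def quot_map_def)
  qed (simp add: repr_def quot_map_def a_def)
  have base: "d1 A b s = infdist s A" "d1 A s b = infdist s A" if "b \<in> A" for b s
    using that infdist_le[OF that, of s] infdist_nonneg[of s A]
    by (auto simp: d1_def dist_commute min_def)
  show ?thesis
    using a by (auto simp: d1bar_def rep base)
qed

section \<open>Diagrams and the metric on \<open>K(X,A)\<close>\<close>

definition drop_base :: "'n option multiset \<Rightarrow> 'n multiset"
  where "drop_base M = image_mset the (filter_mset (\<lambda>u. u \<noteq> None) M)"

definition matchings ::
    "'n multiset \<Rightarrow> 'n multiset \<Rightarrow> ('n option \<times> 'n option) multiset set"
  where "matchings \<alpha> \<beta> =
    {P. drop_base (image_mset fst P) = \<alpha> \<and> drop_base (image_mset snd P) = \<beta>}"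

definition W1 :: "('n option \<Rightarrow> 'n option \<Rightarrow> real) \<Rightarrow> 'n multiset \<Rightarrow> 'n multiset \<Rightarrow> real"
  where "W1 \<delta> \<alpha> \<beta> = (INF P \<in> matchings \<alpha> \<beta>. \<Sum>p\<in>#P. \<delta> (fst p) (snd p))"

definition diagram_class :: "'n::finite multiset \<Rightarrow> int ^ 'n"
  where "diagram_class \<alpha> = (\<chi> j. int (count \<alpha> j))"

definition pos_diagram :: "int ^ 'n::finite \<Rightarrow> 'n multiset"
  where "pos_diagram \<kappa> = (\<Sum>j\<in>UNIV. replicate_mset (nat (\<kappa> $ j)) j)"

text \<open>
  Every \<open>\<kappa>\<close> is the formal difference of \<open>pos_diagram \<kappa>\<close> and \<open>pos_diagram (- \<kappa>)\<close>. Evaluating \<open>\<rho>\<close> on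
  these representatives is no restriction: \<open>rho_diff\<close> gives the formula for arbitrary ones.
\<close>

definition rho ::
    "('n option \<Rightarrow> 'n option \<Rightarrow> real) \<Rightarrow> int ^ 'n::finite \<Rightarrow> int ^ 'n \<Rightarrow> real"
  where "rho \<delta> \<kappa> \<kappa>' =
    W1 \<delta> (pos_diagram \<kappa> + pos_diagram (- \<kappa>')) (pos_diagram \<kappa>' + pos_diagram (- \<kappa>))"

lemma count_pos_diagram: "count (pos_diagram \<kappa>) j = nat (\<kappa> $ j)"
  by (simp add: pos_diagram_def count_sum)

lemma pos_diagram_diff:
  "diagram_class (pos_diagram \<kappa>) - diagram_class (pos_diagram (- \<kappa>)) = \<kappa>"
  by (simp add: vec_eq_iff diagram_class_def count_pos_diagram)

lemma drop_base_add [simp]: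
  "drop_base {#} = {#}"
  "drop_base (add_mset None M) = drop_base M"
  "drop_base (add_mset (Some j) M) = add_mset j (drop_base M)"
  by (simp_all add: drop_base_def)

lemma in_drop_base: "j \<in># drop_base M \<longleftrightarrow> Some j \<in># M"
  by (force simp: drop_base_def)

lemma W1_add_common_single:
  assumes "Metric_space UNIV \<delta>"
  shows "W1 \<delta> (add_mset j \<alpha>) (add_mset j \<beta>) = W1 \<delta> \<alpha> \<beta>"
proof -
  interpret Metric_space UNIV \<delta> by fact
  define cost where "cost = (\<lambda>P::('a option \<times> 'a option) multiset. \<Sum>p\<in>#P. \<delta> (fst p) (snd p))"
  have cost_nonneg: "0 \<le> cost P" for P
    unfolding cost_def by (induction P) auto
  have cost_add: "cost (add_mset p P) = \<delta> (fst p) (snd p) + cost P" for p P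
    by (simp add: cost_def)
  have bdd: "bdd_below (cost ` S)" for S
    using cost_nonneg by (auto intro!: bdd_belowI)
  have nonempty: "matchings \<alpha> \<beta> \<noteq> {}" for \<alpha> \<beta> :: "'a multiset"
  proof -
    define P where "P = image_mset (\<lambda>i. (Some i, None :: 'a option)) \<alpha> +
        image_mset (\<lambda>i. (None :: 'a option, Some i)) \<beta>"
    have "P \<in> matchings \<alpha> \<beta>"
      by (simp add: P_def matchings_def drop_base_def filter_mset_image_mset
          image_mset.compositionality comp_def)
    then show ?thesis by blast
  qed
  have le: "\<exists>Q\<in>matchings \<alpha> \<beta>. cost Q \<le> cost P"
    if "P \<in> matchings (add_mset j \<alpha>) (add_mset j \<beta>)" for P
  proof -
    have P: "drop_base (image_mset fst P) = add_mset j \<alpha>"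
      "drop_base (image_mset snd P) = add_mset j \<beta>"
      using that by (auto simp: matchings_def)
    have "Some j \<in># image_mset fst P"
      using P(1) by (metis in_drop_base union_single_eq_member)
    then obtain v where v: "(Some j, v) \<in># P"
      by force
    then obtain P' where P': "P = add_mset (Some j, v) P'"
      by (metis insert_DiffM)
    show ?thesis
    proof (cases "v = Some j")
      case True
      then have "P' \<in> matchings \<alpha> \<beta>" "cost P' \<le> cost P"
        using P by (auto simp: P' matchings_def cost_add)
      then show ?thesis by blast
    next
      case False
      have "Some j \<in># image_mset snd P"
        using P(2) by (metis in_drop_base union_single_eq_member)
      with False obtain u where "(u, Some j) \<in># P'"
        by (force simp: P')
      then obtain P'' where P'': "P' = add_mset (u, Some j) P''"
        by (metis insert_DiffM)
      have "add_mset (u, v) P'' \<in> matchings \<alpha> \<beta>"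
        using P by (cases u; cases v) (auto simp: P' P'' matchings_def add_mset_commute)
      moreover have "cost (add_mset (u, v) P'') \<le> cost P"
        using triangle[of u "Some j" v] by (simp add: P' P'' cost_add)
      ultimately show ?thesis by blast
    qed
  qed
  have ge: "\<exists>P\<in>matchings (add_mset j \<alpha>) (add_mset j \<beta>). cost P \<le> cost Q"
    if "Q \<in> matchings \<alpha> \<beta>" for Q
    using that by (intro bexI[of _ "add_mset (Some j, Some j) Q"])
      (auto simp: matchings_def cost_add)
  have "Inf (cost ` matchings (add_mset j \<alpha>) (add_mset j \<beta>)) = Inf (cost ` matchings \<alpha> \<beta>)"
    using le ge by (intro antisym cINF_mono nonempty bdd) auto
  then show ?thesis
    by (simp add: W1_def cost_def)
qed

lemma W1_add_common:
  assumes "Metric_space UNIV \<delta>"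
  shows "W1 \<delta> (\<alpha> + \<gamma>) (\<beta> + \<gamma>) = W1 \<delta> \<alpha> \<beta>"
  by (induction \<gamma>) (simp_all add: W1_add_common_single[OF assms])

lemma rho_diff:
  assumes "Metric_space UNIV \<delta>"
  shows "rho \<delta> (diagram_class a - diagram_class b) (diagram_class c - diagram_class e) =
    W1 \<delta> (a + e) (c + b)"
proof -
  define \<kappa> \<kappa>' where "\<kappa> = diagram_class a - diagram_class b"
    and "\<kappa>' = diagram_class c - diagram_class e"
  have eq: "r + pos_diagram (- \<eta>) = s + pos_diagram \<eta>"
    if "\<eta> = diagram_class r - diagram_class s" for \<eta> and r s :: "'a multiset"
    by (rule multiset_eqI) (simp add: that count_pos_diagram diagram_class_def)
  have 1: "a + pos_diagram (- \<kappa>) = b + pos_diagram \<kappa>"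
    and 2: "c + pos_diagram (- \<kappa>') = e + pos_diagram \<kappa>'"
    using eq[OF \<kappa>_def] eq[OF \<kappa>'_def] .
  have "W1 \<delta> (a + e) (c + b) =
      W1 \<delta> ((a + e) + (pos_diagram (- \<kappa>) + pos_diagram (- \<kappa>')))
           ((c + b) + (pos_diagram (- \<kappa>) + pos_diagram (- \<kappa>')))"
    by (simp only: W1_add_common[OF assms])
  also have "(a + e) + (pos_diagram (- \<kappa>) + pos_diagram (- \<kappa>')) =
      (pos_diagram \<kappa> + pos_diagram (- \<kappa>')) + (b + e)"
    using 1 by (metis (no_types, lifting) add.assoc add.commute)
  also have "(c + b) + (pos_diagram (- \<kappa>) + pos_diagram (- \<kappa>')) =
      (pos_diagram \<kappa>' + pos_diagram (- \<kappa>)) + (b + e)"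
    using 2 by (metis (no_types, lifting) add.assoc add.commute)
  finally show ?thesis
    by (simp add: W1_add_common[OF assms] rho_def \<kappa>_def \<kappa>'_def)
qed

section \<open>Characters and phases\<close>

text \<open>
  \<open>[0, 2\<pi>)\<close>-valued angle vectors form a fundamental domain of the torus, and Haar probability measure
  is normalised Lebesgue measure there.
\<close>

definition torus :: "(real ^ 'n::finite) measure"
  where "torus = uniform_measure lborel {\<theta>. \<forall>j. 0 \<le> \<theta> $ j \<and> \<theta> $ j < 2 * pi}"

definition character :: "real ^ 'n::finite \<Rightarrow> int ^ 'n \<Rightarrow> complex"
  where "character \<theta> n = cis (\<Sum>j\<in>UNIV. of_int (n $ j) * \<theta> $ j)"

definition phase :: "real ^ 'n::finite \<Rightarrow> 'n option \<Rightarrow> complex"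
  where "phase \<theta> u = (case u of None \<Rightarrow> 1 | Some j \<Rightarrow> cis (\<theta> $ j))"

section \<open>Weighted graph on \<open>X/A\<close>\<close>

definition walks :: "('v \<Rightarrow> 'v \<Rightarrow> bool) \<Rightarrow> 'v \<Rightarrow> 'v \<Rightarrow> 'v list set"
  where "walks E u v = {p. p \<noteq> [] \<and> hd p = u \<and> last p = v \<and> successively E p}"

definition walk_length :: "('v \<Rightarrow> 'v \<Rightarrow> real) \<Rightarrow> 'v list \<Rightarrow> real"
  where "walk_length len p = (\<Sum>i<length p - 1. len (p ! i) (p ! Suc i))"

definition connected_simple_graph :: "('v \<Rightarrow> 'v \<Rightarrow> bool) \<Rightarrow> bool"
  where "connected_simple_graph E \<longleftrightarrow> symp E \<and> irreflp E \<and> (\<forall>u v. walks E u v \<noteq> {})"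

definition path_metric :: "('v \<Rightarrow> 'v \<Rightarrow> bool) \<Rightarrow> ('v \<Rightarrow> 'v \<Rightarrow> real) \<Rightarrow> 'v \<Rightarrow> 'v \<Rightarrow> real"
  where "path_metric E len u v = (INF p \<in> walks E u v. walk_length len p)"

definition conductances :: "('v \<Rightarrow> 'v \<Rightarrow> bool) \<Rightarrow> ('v \<Rightarrow> 'v \<Rightarrow> real) \<Rightarrow> bool"
  where "conductances E w \<longleftrightarrow>
    (\<forall>u v. w u v = w v u) \<and> (\<forall>u v. E u v \<longrightarrow> w u v > 0) \<and> (\<forall>u v. \<not> E u v \<longrightarrow> w u v = 0)"

definition edge_min :: "('v \<Rightarrow> 'v \<Rightarrow> bool) \<Rightarrow> ('v \<Rightarrow> 'v \<Rightarrow> real) \<Rightarrow> real"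
  where "edge_min E g = Min {g u v | u v. E u v}"

definition dirichlet_energy ::
    "('n option \<Rightarrow> 'n option \<Rightarrow> real) \<Rightarrow> real ^ 'n::finite \<Rightarrow> real"
  where "dirichlet_energy w \<theta> =
    1 / 2 * (\<Sum>u\<in>UNIV. \<Sum>v\<in>UNIV. w u v * (cmod (phase \<theta> u - phase \<theta> v))\<^sup>2)"

section \<open>Heat kernel and reproducing kernel Hilbert spaces\<close>

definition heat_measure ::
    "('n option \<Rightarrow> 'n option \<Rightarrow> real) \<Rightarrow> real \<Rightarrow> (real ^ 'n::finite) measure"
  where "heat_measure w t = density torus (\<lambda>\<theta>. ennreal (exp (- t * dirichlet_energy w \<theta>)))"

definition heat_kernel ::
    "('n option \<Rightarrow> 'n option \<Rightarrow> real) \<Rightarrow> real \<Rightarrow> int ^ 'n::finite \<Rightarrow> int ^ 'n \<Rightarrow> complex"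
  where "heat_kernel w t \<alpha> \<beta> = (LINT \<theta>|heat_measure w t. character \<theta> (\<alpha> - \<beta>))"

definition ip_norm :: "(('k \<Rightarrow> complex) \<Rightarrow> ('k \<Rightarrow> complex) \<Rightarrow> complex) \<Rightarrow> ('k \<Rightarrow> complex) \<Rightarrow> real"
  where "ip_norm ip f = sqrt (Re (ip f f))"

text \<open>
  \<open>ip\<close> is linear in its first argument. The axioms determine \<open>H\<close>, and \<open>ip\<close> on \<open>H\<close>, uniquely
  from \<open>k\<close>.
\<close>

locale rkhs =
  fixes k :: "'k \<Rightarrow> 'k \<Rightarrow> complex"
    and H :: "('k \<Rightarrow> complex) set"
    and ip :: "('k \<Rightarrow> complex) \<Rightarrow> ('k \<Rightarrow> complex) \<Rightarrow> complex"
  assumes zero_mem: "(\<lambda>_. 0) \<in> H"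
    and add_mem: "\<lbrakk>f \<in> H; g \<in> H\<rbrakk> \<Longrightarrow> (\<lambda>\<alpha>. f \<alpha> + g \<alpha>) \<in> H"
    and scale_mem: "f \<in> H \<Longrightarrow> (\<lambda>\<alpha>. c * f \<alpha>) \<in> H"
    and ip_add: "\<lbrakk>f \<in> H; g \<in> H; h \<in> H\<rbrakk> \<Longrightarrow> ip (\<lambda>\<alpha>. f \<alpha> + g \<alpha>) h = ip f h + ip g h"
    and ip_scale: "\<lbrakk>f \<in> H; h \<in> H\<rbrakk> \<Longrightarrow> ip (\<lambda>\<alpha>. c * f \<alpha>) h = c * ip f h"
    and ip_cnj: "\<lbrakk>f \<in> H; g \<in> H\<rbrakk> \<Longrightarrow> ip g f = cnj (ip f g)"
    and ip_nonneg: "f \<in> H \<Longrightarrow> 0 \<le> Re (ip f f)"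
    and ip_definite: "\<lbrakk>f \<in> H; ip f f = 0\<rbrakk> \<Longrightarrow> f = (\<lambda>_. 0)"
    and complete:
      "\<lbrakk>\<And>n. s n \<in> H;
        \<And>e. e > 0 \<Longrightarrow> \<exists>M. \<forall>m\<ge>M. \<forall>n\<ge>M. ip_norm ip (\<lambda>\<alpha>. s m \<alpha> - s n \<alpha>) < e\<rbrakk>
       \<Longrightarrow> \<exists>l\<in>H. (\<lambda>n. ip_norm ip (\<lambda>\<alpha>. s n \<alpha> - l \<alpha>)) \<longlonglongrightarrow> 0"
    and kernel_mem: "(\<lambda>\<beta>. k \<beta> \<alpha>) \<in> H"
    and reproducing: "f \<in> H \<Longrightarrow> f \<alpha> = ip f (\<lambda>\<beta>. k \<beta> \<alpha>)"

end

theory Submission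
  imports Defs
begin

text \<open>
  By the reproducing property and Cauchy--Schwarz, \<open>\<bar>f \<alpha> - f \<beta>\<bar>\<close> is at most the norm of \<open>f\<close> times the
  \<open>L\<^sup>2(\<nu>\<^sub>t)\<close>-norm of \<open>\<theta> \<mapsto> \<chi>\<^sub>\<theta>(\<alpha>) - \<chi>\<^sub>\<theta>(\<beta>)\<close>. A matching of the diagrams writes the quotient of the
  two characters as a product of phase quotients, so the integrand is at most \<open>Lip(\<phi>\<^sub>\<theta>) \<rho>(\<alpha>, \<beta>)\<close>.
  In the density \<open>exp(-t \<lambda>(\<theta>))\<close> the energy is bounded below by the contribution of a single edge:
  since the metric is the path metric, \<open>Lip(\<phi>\<^sub>\<theta>)\<close> is attained on an edge, and a chord is at least
  \<open>2 / \<pi>\<close> times its arc.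
\<close>

section \<open>Arc length\<close>

text \<open>Rounding \<open>c / (2 * pi)\<close> to the nearest integer leaves a remainder of size
  at most pi; any other shift moves it by at least a full turn, so it cannot end closer to 0. Later
  proofs calculate with this concrete minimiser.\<close>

lemma arc_inf_attained:
  obtains m :: int where "\<bar>c + 2 * pi * of_int m\<bar> \<le> pi"
    and "(INF k::int. \<bar>c + 2 * pi * of_int k\<bar>) = \<bar>c + 2 * pi * of_int m\<bar>"
proof -
  define y where "y = c / (2 * pi)"
  define m where "m = - round y"
  define e where "e = c + 2 * pi * of_int m"
  have "\<bar>of_int (round y) - y\<bar> \<le> 1 / 2"
    by (rule of_int_round_abs_le)
  then have "\<bar>of_int (round y) - y\<bar> * (2 * pi) \<le> 1 / 2 * (2 * pi)"
    by (intro mult_right_mono) auto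
  moreover have "\<bar>of_int (round y) - y\<bar> * (2 * pi) = \<bar>e\<bar>"
  proof -
    have "c = 2 * pi * y"
      by (simp add: y_def)
    then have "(of_int (round y) - y) * (2 * pi) = - e"
      by (simp add: e_def m_def algebra_simps)
    then have "\<bar>(of_int (round y) - y) * (2 * pi)\<bar> = \<bar>e\<bar>"
      by simp
    then show ?thesis
      by (simp add: abs_mult)
  qed
  ultimately have e: "\<bar>e\<bar> \<le> pi" by simp
  have min: "\<bar>e\<bar> \<le> \<bar>c + 2 * pi * of_int k\<bar>" for k :: int
  proof (cases "k = m")
    case False
    have "1 \<le> \<bar>of_int (k - m) :: real\<bar>"
      using False by linarith
    then have "2 * pi * 1 \<le> 2 * pi * \<bar>of_int (k - m) :: real\<bar>"
      by (intro mult_left_mono) auto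
    then have "2 * pi \<le> \<bar>2 * pi * of_int (k - m)\<bar>"
      by (simp add: abs_mult)
    moreover have "c + 2 * pi * of_int k = e + 2 * pi * of_int (k - m)"
      by (simp add: e_def algebra_simps)
    ultimately show ?thesis
      using e by linarith
  qed (simp add: e_def)
  have "(INF k::int. \<bar>c + 2 * pi * of_int k\<bar>) = \<bar>e\<bar>"
    by (intro cInf_eq_minimum) (use min in \<open>auto simp: e_def\<close>)
  with e show ?thesis
    by (intro that[of m]) (simp_all add: e_def)
qed

lemma arc_dist_nonneg: "0 \<le> arc_dist z w"
  unfolding arc_dist_def by (rule cINF_greatest) auto

lemma arc_dist_le: "arc_dist z w \<le> \<bar>Arg z - Arg w + 2 * pi * of_int k\<bar>"
  unfolding arc_dist_def by (rule cINF_lower) (auto intro!: bdd_belowI[of _ 0])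

text \<open>Optimal shifts for the two arcs through \<open>w\<close> add up to an admissible shift
  for the arc from \<open>z\<close> to \<open>v\<close>.\<close>

lemma arc_dist_triangle: "arc_dist z v \<le> arc_dist z w + arc_dist w v"
proof -
  obtain m n :: int where "arc_dist z w = \<bar>Arg z - Arg w + 2 * pi * of_int m\<bar>"
    and "arc_dist w v = \<bar>Arg w - Arg v + 2 * pi * of_int n\<bar>"
    unfolding arc_dist_def using arc_inf_attained by metis
  moreover have "Arg z - Arg v + 2 * pi * of_int (m + n) =
      (Arg z - Arg w + 2 * pi * of_int m) + (Arg w - Arg v + 2 * pi * of_int n)"
    by (simp add: algebra_simps)
  ultimately show ?thesis
    using arc_dist_le[of z v "m + n"] by linarith
qed

section \<open>Chord against arc on the unit circle\<close>

lemma cmod_cis_diff: "cmod (cis a - cis b) = 2 * \<bar>sin ((a - b) / 2)\<bar>"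
proof (rule power2_eq_imp_eq)
  have "(cmod (cis a - cis b))\<^sup>2 = (cos a - cos b)\<^sup>2 + (sin a - sin b)\<^sup>2"
    by (simp add: cmod_power2)
  also have "\<dots> = 2 - 2 * cos (a - b)"
    using sin_cos_squared_add[of a] sin_cos_squared_add[of b]
    unfolding cos_diff by algebra
  also have "\<dots> = (2 * \<bar>sin ((a - b) / 2)\<bar>)\<^sup>2"
  proof -
    define h where "h = (a - b) / 2"
    have "a - b = 2 * h"
      by (simp add: h_def)
    then show ?thesis
      by (simp add: cos_double_sin power_mult_distrib)
  qed
  finally show "(cmod (cis a - cis b))\<^sup>2 = (2 * \<bar>sin ((a - b) / 2)\<bar>)\<^sup>2" .
qed auto

text \<open>Half the optimal angle difference lies in [-pi/2, pi/2], where arcsin inverts sin. The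
  formula removes the branch of \<open>Arg\<close> and the infimum; it serves both the chord bounds
  and measurability in \<theta>.\<close>

lemma arc_dist_chord:
  assumes "cmod z = 1" "cmod w = 1"
  shows "arc_dist z w = 2 * arcsin (cmod (z - w) / 2)" and "arc_dist z w \<le> pi"
proof -
  obtain m :: int where m: "\<bar>Arg z - Arg w + 2 * pi * of_int m\<bar> \<le> pi"
    "arc_dist z w = \<bar>Arg z - Arg w + 2 * pi * of_int m\<bar>"
    unfolding arc_dist_def using arc_inf_attained by metis
  define e where "e = Arg z - Arg w + 2 * pi * of_int m"
  have zw: "z = cis (Arg z)" "w = cis (Arg w)"
    using assms cis_Arg_unique by (metis cis_Arg norm_zero sgn_eq div_by_1 of_real_1 zero_neq_one)+
  have "cis (Arg z + 2 * pi * of_int m) = z"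
    using zw(1) by (simp add: cis_mult[symmetric] cis_multiple_2pi)
  then have "cmod (z - w) = 2 * \<bar>sin (e / 2)\<bar>"
    using cmod_cis_diff[of "Arg z + 2 * pi * of_int m" "Arg w"] zw(2)
    by (simp add: e_def algebra_simps)
  also have "\<bar>sin (e / 2)\<bar> = sin (\<bar>e\<bar> / 2)"
  proof -
    have "0 \<le> sin (\<bar>e\<bar> / 2)"
      using m(1) by (intro sin_ge_zero) (auto simp: e_def)
    then show ?thesis
      by (cases "0 \<le> e") (auto simp: abs_if)
  qed
  finally have "arcsin (cmod (z - w) / 2) = \<bar>e\<bar> / 2"
    using m(1) by (simp add: e_def arcsin_sin)
  then show "arc_dist z w = 2 * arcsin (cmod (z - w) / 2)"
    using m(2) by (simp add: e_def)
  show "arc_dist z w \<le> pi"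
    using m by simp
qed

text \<open>Half the chord is the sine of half the arc, and sin x \<le> x for nonnegative x.\<close>

lemma chord_le_arc_dist:
  assumes "cmod z = 1" "cmod w = 1"
  shows "cmod (z - w) \<le> arc_dist z w"
proof -
  have "cmod (z - w) / 2 \<le> 1"
    using norm_triangle_ineq4[of z w] assms by simp
  then have "cmod (z - w) / 2 = sin (arcsin (cmod (z - w) / 2))"
    by (subst sin_arcsin) (auto intro: order_trans[of _ 0])
  also have "\<dots> \<le> arcsin (cmod (z - w) / 2)"
    using arc_dist_nonneg[of z w] arc_dist_chord(1)[OF assms] by (intro sin_x_le_x) simp
  finally show ?thesis
    using arc_dist_chord(1)[OF assms] by simp
qed

text \<open>Jordan's inequality: sine is concave on [0, pi], so on [0, pi/2] its graph lies above
  the secant through 0 and pi/2.\<close>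

lemma jordan_sin_ge:
  assumes "0 \<le> y" "y \<le> pi / 2"
  shows "2 / pi * y \<le> sin y"
proof -
  have "concave_on {0..pi} sin"
    unfolding concave_on_def
    by (rule f''_ge0_imp_convex[where f' = "\<lambda>x. - cos x" and f'' = "\<lambda>x. sin x"])
      (auto intro!: derivative_eq_intros sin_ge_zero)
  then have "(1 - 2 / pi * y) * sin 0 + (2 / pi * y) * sin (pi / 2)
      \<le> sin ((1 - 2 / pi * y) *\<^sub>R 0 + (2 / pi * y) *\<^sub>R (pi / 2))"
    using assms by (intro concave_onD) (auto simp: field_simps)
  then show ?thesis by simp
qed

lemma arc_dist_le_chord:
  assumes "cmod z = 1" "cmod w = 1"
  shows "2 / pi * arc_dist z w \<le> cmod (z - w)"
proof -
  let ?y = "arcsin (cmod (z - w) / 2)"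
  have "cmod (z - w) / 2 \<le> 1"
    using norm_triangle_ineq4[of z w] assms by simp
  then have "sin ?y = cmod (z - w) / 2"
    by (subst sin_arcsin) (auto intro: order_trans[of _ 0])
  moreover have "2 / pi * ?y \<le> sin ?y"
    using arc_dist_nonneg[of z w] arc_dist_chord[OF assms] by (intro jordan_sin_ge) auto
  ultimately show ?thesis
    using arc_dist_chord(1)[OF assms] by simp
qed

section \<open>Lipschitz seminorms on finite spaces\<close>

text \<open>A finite domain keeps \<open>Lip\<close> below infinity, so \<open>enn2real\<close> does
  not collapse it to 0 and still dominates each ratio.\<close>

lemma Lip_ratio_le:
  fixes f :: "'p::finite \<Rightarrow> 'q"
  assumes "a \<noteq> b"
  shows "\<rho>2 (f a) (f b) / \<rho>1 a b \<le> enn2real (Lip \<rho>1 \<rho>2 f)"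
proof -
  have "ennreal (\<rho>2 (f a) (f b) / \<rho>1 a b) \<le> Lip \<rho>1 \<rho>2 f"
    unfolding Lip_def using assms by (intro SUP_upper2[of "(a, b)"]) auto
  also have "\<dots> = ennreal (enn2real (Lip \<rho>1 \<rho>2 f))"
    using Lip_finite[of \<rho>1 \<rho>2 f] by (simp add: less_top)
  finally show ?thesis
    by (simp add: ennreal_le_iff)
qed

lemma Lip_leI:
  assumes "\<And>a b. a \<noteq> b \<Longrightarrow> \<rho>2 (f a) (f b) / \<rho>1 a b \<le> C"
  shows "Lip \<rho>1 \<rho>2 f \<le> ennreal C"
  unfolding Lip_def using assms by (auto intro!: SUP_least ennreal_leI)

text \<open>Passes a bound valid for every competitor to the infimum, once over matchings and once
  over walks. The argument divides by \<open>M\<close>, hence the separate case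
  \<open>M = 0\<close>.\<close>

lemma le_mult_cINF:
  fixes g :: "'p \<Rightarrow> real"
  assumes "S \<noteq> {}" "0 \<le> M" "\<And>p. p \<in> S \<Longrightarrow> c \<le> M * g p"
  shows "c \<le> M * (INF p\<in>S. g p)"
proof (cases "M = 0")
  case True
  with assms show ?thesis by fastforce
next
  case False
  with assms(2) have "0 < M" by simp
  then have "c / M \<le> (INF p\<in>S. g p)"
    using assms by (intro cINF_greatest) (auto simp: field_simps)
  with \<open>0 < M\<close> show ?thesis
    by (simp add: field_simps)
qed

section \<open>Characters are Lipschitz\<close>

lemma norm_phase [simp]: "cmod (phase \<theta> u) = 1"
  by (simp add: phase_def split: option.split)

text \<open>The basepoint has phase 1, so discarding \<open>None\<close> does not change the
  product; a multiset on the quotient enters only through its diagram.\<close>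

lemma prod_mset_phase:
  "(\<Prod>u\<in>#M. phase \<theta> u) = cis (\<Sum>j\<in>UNIV. real (count (drop_base M) j) * \<theta> $ j)"
proof (induction M)
  case (add u M)
  show ?case
  proof (cases u)
    case (Some j)
    have "(\<Sum>i\<in>UNIV. real (count (add_mset j (drop_base M)) i) * \<theta> $ i) =
        (\<Sum>i\<in>UNIV. (if i = j then \<theta> $ i else 0) + real (count (drop_base M) i) * \<theta> $ i)"
      by (intro sum.cong) (auto simp: algebra_simps)
    also have "\<dots> = \<theta> $ j + (\<Sum>i\<in>UNIV. real (count (drop_base M) i) * \<theta> $ i)"
      by (simp add: sum.distrib)
    finally show ?thesis
      using add Some by (simp add: phase_def cis_mult)
  qed (use add in \<open>simp add: phase_def\<close>)
qed simp

text \<open>Telescoping: the factors are exchanged one at a time while the remaining ones have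
  modulus 1.\<close>

lemma norm_prod_mset_diff_le:
  fixes g h :: "'p \<Rightarrow> 'b::real_normed_field"
  assumes "\<And>p. norm (g p) = 1" "\<And>p. norm (h p) = 1"
  shows "norm ((\<Prod>p\<in>#P. g p) - (\<Prod>p\<in>#P. h p)) \<le> (\<Sum>p\<in>#P. norm (g p - h p))"
proof (induction P)
  case (add p P)
  have 1: "norm (\<Prod>q\<in>#P. h q) = 1"
    using assms(2) by (induction P) (auto simp: norm_mult)
  have "g p * (\<Prod>q\<in>#P. g q) - h p * (\<Prod>q\<in>#P. h q) =
      g p * ((\<Prod>q\<in>#P. g q) - (\<Prod>q\<in>#P. h q)) + (g p - h p) * (\<Prod>q\<in>#P. h q)"
    by (simp add: algebra_simps)
  also have "norm \<dots> \<le> norm ((\<Prod>q\<in>#P. g q) - (\<Prod>q\<in>#P. h q)) + norm (g p - h p)"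
    by (rule norm_triangle_le) (simp add: norm_mult assms(1) 1)
  finally show ?case
    using add by simp
qed simp

text \<open>Every point may be matched with the basepoint. A real infimum over the empty set would
  carry no information.\<close>

lemma matchings_nonempty: "matchings \<alpha> \<beta> \<noteq> {}"
proof -
  have "image_mset (\<lambda>i. (Some i, None)) \<alpha> + image_mset (\<lambda>i. (None, Some i)) \<beta> \<in> matchings \<alpha> \<beta>"
    by (simp add: matchings_def drop_base_def filter_mset_image_mset
        image_mset.compositionality comp_def)
  then show ?thesis by blast
qed

lemma W1_nonneg:
  assumes "Metric_space UNIV \<delta>"
  shows "0 \<le> W1 \<delta> \<alpha> \<beta>"
  unfolding W1_def
proof (intro cINF_greatest matchings_nonempty)
  interpret Metric_space UNIV \<delta> by fact
  show "0 \<le> (\<Sum>p\<in>#P. \<delta> (fst p) (snd p))" for P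
    by (induction P) auto
qed

text \<open>Each pair of a matching costs at most \<open>Lip\<close> times its length, since chords
  are no longer than arcs; telescoping adds the costs, and the infimum over matchings is the
  metric.\<close>

lemma character_lipschitz:
  fixes \<theta> :: "real ^ 'n::finite"
  assumes "Metric_space UNIV \<delta>"
  shows "cmod (character \<theta> \<kappa> - character \<theta> \<kappa>') \<le>
    enn2real (Lip \<delta> arc_dist (phase \<theta>)) * rho \<delta> \<kappa> \<kappa>'"
  unfolding rho_def W1_def
proof (intro le_mult_cINF matchings_nonempty)
  interpret Metric_space UNIV \<delta> by fact
  let ?L = "enn2real (Lip \<delta> arc_dist (phase \<theta>))"
  let ?\<alpha> = "pos_diagram \<kappa> + pos_diagram (- \<kappa>')" and ?\<beta> = "pos_diagram \<kappa>' + pos_diagram (- \<kappa>)"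
  fix P assume P: "P \<in> matchings ?\<alpha> ?\<beta>"
  have "cmod (character \<theta> \<kappa> - character \<theta> \<kappa>') =
      cmod ((\<Prod>p\<in>#P. phase \<theta> (fst p)) - (\<Prod>p\<in>#P. phase \<theta> (snd p)))"
  proof -
    have "(\<Prod>p\<in>#P. phase \<theta> (fst p)) = cis (\<Sum>j\<in>UNIV. real (count ?\<alpha> j) * \<theta> $ j)"
      "(\<Prod>p\<in>#P. phase \<theta> (snd p)) = cis (\<Sum>j\<in>UNIV. real (count ?\<beta> j) * \<theta> $ j)"
      using P prod_mset_phase[of \<theta> "image_mset fst P"] prod_mset_phase[of \<theta> "image_mset snd P"]
      by (simp_all add: matchings_def image_mset.compositionality comp_def)
    \<comment> \<open>The two products are not the two characters themselves: both are rotated by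
      the angle of \<open>pos_diagram (- \<kappa>) + pos_diagram (- \<kappa>')\<close>. Only the
      difference of angles enters \<open>cmod_cis_diff\<close>.\<close>
    moreover have "(\<Sum>j\<in>UNIV. real (count ?\<alpha> j) * \<theta> $ j) - (\<Sum>j\<in>UNIV. real (count ?\<beta> j) * \<theta> $ j) =
        (\<Sum>j\<in>UNIV. of_int (\<kappa> $ j) * \<theta> $ j) - (\<Sum>j\<in>UNIV. of_int (\<kappa>' $ j) * \<theta> $ j)"
      unfolding sum_subtractf[symmetric]
    proof (intro sum.cong refl)
      fix j
      have "real (count ?\<alpha> j) - real (count ?\<beta> j) = of_int (\<kappa> $ j) - of_int (\<kappa>' $ j)"
        by (simp add: count_pos_diagram)
      then show "real (count ?\<alpha> j) * \<theta> $ j - real (count ?\<beta> j) * \<theta> $ j =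
          of_int (\<kappa> $ j) * \<theta> $ j - of_int (\<kappa>' $ j) * \<theta> $ j"
        by (metis left_diff_distrib)
    qed
    ultimately show ?thesis
      by (simp only: character_def cmod_cis_diff)
  qed
  also have "\<dots> \<le> (\<Sum>p\<in>#P. cmod (phase \<theta> (fst p) - phase \<theta> (snd p)))"
    by (rule norm_prod_mset_diff_le) auto
  also have "\<dots> \<le> (\<Sum>p\<in>#P. ?L * \<delta> (fst p) (snd p))"
  proof (rule sum_mset_mono)
    fix p
    show "cmod (phase \<theta> (fst p) - phase \<theta> (snd p)) \<le> ?L * \<delta> (fst p) (snd p)"
    proof (cases "fst p = snd p")
      case False
      then have "0 < \<delta> (fst p) (snd p)"
        by simp
      moreover have "cmod (phase \<theta> (fst p) - phase \<theta> (snd p)) \<le>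
          arc_dist (phase \<theta> (fst p)) (phase \<theta> (snd p))"
        by (rule chord_le_arc_dist) auto
      moreover have "arc_dist (phase \<theta> (fst p)) (phase \<theta> (snd p)) / \<delta> (fst p) (snd p) \<le> ?L"
        using False by (rule Lip_ratio_le)
      ultimately show ?thesis
        by (simp add: pos_divide_le_eq)
    qed simp
  qed
  also have "\<dots> = ?L * (\<Sum>p\<in>#P. \<delta> (fst p) (snd p))"
    by (simp add: sum_mset_distrib_left)
  finally show "cmod (character \<theta> \<kappa> - character \<theta> \<kappa>') \<le> ?L * (\<Sum>p\<in>#P. \<delta> (fst p) (snd p))" .
qed auto

section \<open>Lower bound for the Dirichlet energy\<close>

text \<open>The triangle inequality for arcs, summed along the walk.\<close>

lemma arc_dist_le_walk_length:
  assumes "p \<noteq> []" "successively E p"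
    and "\<And>u v. E u v \<Longrightarrow> arc_dist (g u) (g v) \<le> M * len u v"
  shows "arc_dist (g (hd p)) (g (last p)) \<le> M * walk_length len p"
  using assms(1,2)
proof (induction p)
  case (Cons u p)
  show ?case
  proof (cases p)
    case Nil
    \<comment> \<open>A one-vertex walk has length 0, so the arc from a point to itself has to
      vanish; the shift 0 shows it.\<close>
    have "arc_dist (g u) (g u) \<le> 0"
      using arc_dist_le[of "g u" "g u" 0] by simp
    then show ?thesis
      by (simp add: Nil walk_length_def)
  next
    case (Cons v q)
    have "walk_length len (u # p) = len u v + walk_length len p"
      unfolding walk_length_def Cons by (simp add: sum.lessThan_Suc_shift del: sum.lessThan_Suc)
    moreover have "arc_dist (g v) (g (last p)) \<le> M * walk_length len p"
      using Cons.IH Cons.prems Cons by simp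
    moreover have "arc_dist (g u) (g v) \<le> M * len u v"
      using Cons.prems Cons assms(3) by simp
    ultimately show ?thesis
      using arc_dist_triangle[of "g u" "g (last p)" "g v"] Cons by (simp add: algebra_simps)
  qed
qed simp

text \<open>A walk between distinct vertices has a first step. This makes the sets behind edge
  maxima and minima nonempty.\<close>

lemma connected_simple_graph_has_edge:
  fixes E :: "'v \<Rightarrow> 'v \<Rightarrow> bool" and a b :: 'v
  assumes "connected_simple_graph E" "a \<noteq> b"
  obtains u v where "E u v"
proof -
  obtain p where "p \<in> walks E a b"
    using assms(1) unfolding connected_simple_graph_def by blast
  then have "p \<noteq> []" "hd p \<noteq> last p" "successively E p"
    using assms(2) by (auto simp: walks_def)
  \<comment> \<open>\<open>remdups_adj.cases\<close> serves only as a split into lists of length 0,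
    1 and at least 2.\<close>
  then obtain u v q where "p = u # v # q"
    by (cases p rule: remdups_adj.cases) auto
  with \<open>successively E p\<close> that show ?thesis
    by auto
qed

lemma finite_edge_values: "finite {g u v | u v. E u v}" for E :: "'v::finite \<Rightarrow> 'v \<Rightarrow> bool"
  by (rule finite_subset[of _ "(\<lambda>(u, v). g u v) ` UNIV"]) auto

lemma edge_min_le: "E u v \<Longrightarrow> edge_min E g \<le> g u v" for E :: "'v::finite \<Rightarrow> 'v \<Rightarrow> bool"
  unfolding edge_min_def by (rule Min_le[OF finite_edge_values]) auto

lemma edge_min_pos:
  fixes E :: "'v::finite \<Rightarrow> 'v \<Rightarrow> bool"
  assumes "E a b" "\<And>u v. E u v \<Longrightarrow> 0 < g u v"
  shows "0 < edge_min E g"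
  unfolding edge_min_def
  by (subst Min_gr_iff[OF finite_edge_values]) (use assms in auto)

text \<open>Let M be the largest ratio over edges. Arcs are at most M times the length of any walk,
  hence at most M times the path metric, which is \<delta>; so M bounds the ratio of every
  pair.\<close>

lemma Lip_le_edge_ratio:
  fixes E :: "'v::finite \<Rightarrow> 'v \<Rightarrow> bool" and a b :: 'v
  assumes "Metric_space UNIV \<delta>" "connected_simple_graph E" "a \<noteq> b"
    and "\<forall>u v. path_metric E \<delta> u v = \<delta> u v"
  obtains u v where "E u v" "enn2real (Lip \<delta> arc_dist g) \<le> arc_dist (g u) (g v) / \<delta> u v"
proof -
  interpret Metric_space UNIV \<delta> by fact
  define R where "R = {arc_dist (g u) (g v) / \<delta> u v | u v. E u v}"
  obtain u\<^sub>0 v\<^sub>0 where "E u\<^sub>0 v\<^sub>0"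
    using connected_simple_graph_has_edge[OF assms(2,3)] by blast
  then have "R \<noteq> {}"
    by (auto simp: R_def)
  have "finite R"
    unfolding R_def by (rule finite_edge_values)
  with \<open>R \<noteq> {}\<close> have "Max R \<in> R"
    by (simp add: Max_in)
  then obtain u v where uv: "E u v" "Max R = arc_dist (g u) (g v) / \<delta> u v"
    by (auto simp: R_def)
  have M0: "0 \<le> Max R"
    using uv arc_dist_nonneg nonneg by simp
  have edge: "arc_dist (g u') (g v') \<le> Max R * \<delta> u' v'" if "E u' v'" for u' v'
  proof -
    have "u' \<noteq> v'"
      using that assms(2) by (auto simp: connected_simple_graph_def irreflp_def)
    then have "0 < \<delta> u' v'"
      by simp
    moreover have "arc_dist (g u') (g v') / \<delta> u' v' \<le> Max R"
      using that \<open>finite R\<close> by (intro Max_ge) (auto simp: R_def)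
    ultimately show ?thesis
      by (simp add: pos_divide_le_eq)
  qed
  have "arc_dist (g u') (g v') / \<delta> u' v' \<le> Max R" if "u' \<noteq> v'" for u' v'
  proof -
    have "arc_dist (g u') (g v') \<le> Max R * path_metric E \<delta> u' v'"
      unfolding path_metric_def
    proof (intro le_mult_cINF M0)
      show "walks E u' v' \<noteq> {}"
        using assms(2) by (simp add: connected_simple_graph_def)
      show "arc_dist (g u') (g v') \<le> Max R * walk_length \<delta> p" if "p \<in> walks E u' v'" for p
        using arc_dist_le_walk_length[of p E g "Max R" \<delta>] edge that by (auto simp: walks_def)
    qed
    moreover have "0 < \<delta> u' v'"
      using that by simp
    ultimately show ?thesis
      using assms(4) by (simp add: pos_divide_le_eq)
  qed
  then have "Lip \<delta> arc_dist g \<le> ennreal (Max R)"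
    by (rule Lip_leI)
  then have "enn2real (Lip \<delta> arc_dist g) \<le> Max R"
    using M0 by (simp add: enn2real_leI)
  with uv that show ?thesis
    by simp
qed

text \<open>The double sum over ordered pairs meets this pair twice, which offsets the factor 1/2;
  all other terms are nonnegative.\<close>

lemma dirichlet_energy_ge_edge:
  fixes \<theta> :: "real ^ 'n::finite"
  assumes "conductances E w" "u \<noteq> v"
  shows "w u v * (cmod (phase \<theta> u - phase \<theta> v))\<^sup>2 \<le> dirichlet_energy w \<theta>"
proof -
  let ?F = "\<lambda>(u, v). w u v * (cmod (phase \<theta> u - phase \<theta> v))\<^sup>2"
  have w: "0 \<le> w a b" "w a b = w b a" for a b
    using assms(1) by (cases "E a b"; force simp: conductances_def)+
  have "(\<Sum>p\<in>{(u, v), (v, u)}. ?F p) \<le> (\<Sum>p\<in>UNIV \<times> UNIV. ?F p)"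
    by (rule sum_mono2) (auto intro!: mult_nonneg_nonneg w)
  also have "\<dots> = 2 * dirichlet_energy w \<theta>"
    by (simp add: dirichlet_energy_def sum.cartesian_product)
  also have "(\<Sum>p\<in>{(u, v), (v, u)}. ?F p) = 2 * ?F (u, v)"
    using assms(2) by (simp add: w(2)[of v u] norm_minus_commute)
  finally show ?thesis
    by simp
qed

text \<open>On an edge realising \<open>Lip\<close>, the product of
  \<open>edge_min E \<delta>\<close> and \<open>Lip\<close> is at most the arc, and 2/pi times the
  arc is at most the chord. Squaring gives 4/pi^2, and the conductance of that edge is at least
  \<open>edge_min E w\<close>.\<close>

lemma dirichlet_energy_ge_Lip:
  fixes \<theta> :: "real ^ 'n::finite"
  assumes "Metric_space UNIV \<delta>" "connected_simple_graph E"
    and "\<forall>u v. path_metric E \<delta> u v = \<delta> u v" "conductances E w"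
  shows "4 * edge_min E w * (edge_min E \<delta>)\<^sup>2 / pi\<^sup>2 * (enn2real (Lip \<delta> arc_dist (phase \<theta>)))\<^sup>2
    \<le> dirichlet_energy w \<theta>"
proof -
  interpret Metric_space UNIV \<delta> by fact
  let ?L = "enn2real (Lip \<delta> arc_dist (phase \<theta>))"
  have pos: "0 < w u v" "u \<noteq> v" "0 < \<delta> u v" if "E u v" for u v
    using that assms(2,4) by (auto simp: conductances_def connected_simple_graph_def irreflp_def)
  \<comment> \<open>\<open>None\<close> and \<open>Some undefined\<close> serve as two distinct
    vertices.\<close>
  obtain u v where uv: "E u v" "?L \<le> arc_dist (phase \<theta> u) (phase \<theta> v) / \<delta> u v"
    using Lip_le_edge_ratio[OF assms(1,2) option.distinct(1)[of undefined] assms(3)] by blast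
  have "edge_min E \<delta> * ?L \<le> \<delta> u v * ?L"
    using uv(1) by (intro mult_right_mono edge_min_le[where E = E]) auto
  also have "\<dots> \<le> arc_dist (phase \<theta> u) (phase \<theta> v)"
    using uv pos(3)[OF uv(1)] by (simp add: pos_le_divide_eq mult.commute)
  finally have "2 / pi * (edge_min E \<delta> * ?L) \<le> 2 / pi * arc_dist (phase \<theta> u) (phase \<theta> v)"
    by (rule mult_left_mono) simp
  also have "\<dots> \<le> cmod (phase \<theta> u - phase \<theta> v)"
    by (rule arc_dist_le_chord) auto
  finally have "(2 / pi * (edge_min E \<delta> * ?L))\<^sup>2 \<le> (cmod (phase \<theta> u - phase \<theta> v))\<^sup>2"
    using edge_min_pos[where E = E and g = \<delta>] uv(1) pos(3) by (intro power_mono) (auto simp: less_imp_le)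
  then have "edge_min E w * (2 / pi * (edge_min E \<delta> * ?L))\<^sup>2 \<le>
      w u v * (cmod (phase \<theta> u - phase \<theta> v))\<^sup>2"
    using edge_min_le[where E = E and g = w] uv(1) pos(1)[OF uv(1)] by (intro mult_mono) auto
  also have "\<dots> \<le> dirichlet_energy w \<theta>"
    using assms(4) pos(2)[OF uv(1)] by (rule dirichlet_energy_ge_edge)
  finally show ?thesis
    by (simp add: power_mult_distrib power_divide algebra_simps)
qed

section \<open>Cauchy--Schwarz in a reproducing kernel Hilbert space\<close>

context rkhs
begin

lemma ip_add_right: "\<lbrakk>f \<in> H; g \<in> H; h \<in> H\<rbrakk> \<Longrightarrow> ip h (\<lambda>\<alpha>. f \<alpha> + g \<alpha>) = ip h f + ip h g"
  using ip_cnj[of "\<lambda>\<alpha>. f \<alpha> + g \<alpha>" h] ip_cnj[of f h] ip_cnj[of g h] ip_add[of f g h] add_mem[of f g]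
  by simp

lemma ip_scale_right: "\<lbrakk>f \<in> H; h \<in> H\<rbrakk> \<Longrightarrow> ip h (\<lambda>\<alpha>. c * f \<alpha>) = cnj c * ip h f"
  using ip_cnj[of "\<lambda>\<alpha>. c * f \<alpha>" h] ip_cnj[of f h] ip_scale[of f h c] scale_mem[of f c]
  by simp

lemma ip_diff_right:
  assumes "f \<in> H" "g \<in> H" "h \<in> H"
  shows "ip h (\<lambda>\<alpha>. f \<alpha> - g \<alpha>) = ip h f - ip h g"
  using ip_add_right[OF assms(1) scale_mem[OF assms(2), of "- 1"] assms(3)]
    ip_scale_right[OF assms(2,3), of "- 1"] by simp

lemma diff_mem: "\<lbrakk>f \<in> H; g \<in> H\<rbrakk> \<Longrightarrow> (\<lambda>\<alpha>. f \<alpha> - g \<alpha>) \<in> H"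
  using add_mem[of f "\<lambda>\<alpha>. - 1 * g \<alpha>"] scale_mem[of g "- 1"] by simp

lemma cauchy_schwarz:
  assumes f: "f \<in> H" and g: "g \<in> H"
  shows "cmod (ip f g) \<le> ip_norm ip f * ip_norm ip g"
proof -
  define G where "G = Re (ip g g)"
  define S where "S = ip f g"
  have gg: "ip g g = of_real G"
    using ip_cnj[OF g g] by (simp add: complex_eq_iff G_def)
  have G0: "0 \<le> G"
    using ip_nonneg[OF g] by (simp add: G_def)
  have "(cmod S)\<^sup>2 \<le> Re (ip f f) * G"
  proof (cases "G = 0")
    case True
    then have "g = (\<lambda>_. 0)"
      using ip_definite[OF g] gg by simp
    then have "S = 0"
      using ip_scale_right[OF g f, of 0] by (simp add: S_def)
    then show ?thesis
      using True by simp
  next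
    case False
    \<comment> \<open>This coefficient makes \<open>h\<close> the component of \<open>f\<close>
      orthogonal to \<open>g\<close>; nonnegativity of its squared norm is the inequality.\<close>
    define c where "c = - S / of_real G"
    define h where "h = (\<lambda>\<alpha>. f \<alpha> + c * g \<alpha>)"
    have cg: "(\<lambda>\<alpha>. c * g \<alpha>) \<in> H" and h: "h \<in> H"
      unfolding h_def using f g by (auto intro: scale_mem add_mem)
    have "ip h h = ip f f + cnj c * S + (c * cnj S + c * cnj c * of_real G)"
      unfolding h_def S_def gg[symmetric]
      using f g cg ip_cnj[OF f g] h[unfolded h_def]
      by (simp add: ip_add ip_add_right ip_scale ip_scale_right algebra_simps)
    also have "\<dots> = ip f f - of_real ((cmod S)\<^sup>2 / G)"
      unfolding of_real_divide complex_norm_square c_def using False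
      by (simp add: field_simps)
    finally have "0 \<le> Re (ip f f) - (cmod S)\<^sup>2 / G"
      using ip_nonneg[OF h] by simp
    then show ?thesis
      using False G0 by (simp add: field_simps)
  qed
  then have "cmod S \<le> sqrt (Re (ip f f) * G)"
    by (rule real_le_rsqrt)
  then show ?thesis
    by (simp add: ip_norm_def real_sqrt_mult G_def S_def)
qed

text \<open>The difference of evaluations is the inner product with \<open>g\<close>, a difference
  of kernel sections. Evaluating \<open>g\<close> itself in the same way writes its squared norm as
  four kernel values.\<close>

lemma norm_eval_diff_le:
  assumes f: "f \<in> H"
  shows "cmod (f \<alpha> - f \<beta>) \<le> ip_norm ip f * sqrt (Re (k \<alpha> \<alpha> - k \<alpha> \<beta> - k \<beta> \<alpha> + k \<beta> \<beta>))"
proof -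
  define g where "g = (\<lambda>\<gamma>. k \<gamma> \<alpha> - k \<gamma> \<beta>)"
  have g: "g \<in> H"
    unfolding g_def by (intro diff_mem kernel_mem)
  have eval: "ip h g = h \<alpha> - h \<beta>" if "h \<in> H" for h
    unfolding g_def using that by (simp add: ip_diff_right kernel_mem reproducing[symmetric])
  show ?thesis
    using cauchy_schwarz[OF f g] unfolding eval[OF f] ip_norm_def[of ip g] eval[OF g]
    unfolding g_def by (simp add: algebra_simps)
qed

end

section \<open>Integration over the torus\<close>

text \<open>The half-open cube lies between an open and a closed box: the first makes its measure
  positive, the second finite, so normalising is possible.\<close>

lemma prob_space_torus: "prob_space (torus :: (real ^ 'n::finite) measure)"
proof -
  let ?S = "{\<theta> :: real ^ 'n. \<forall>j. 0 \<le> \<theta> $ j \<and> \<theta> $ j < 2 * pi}"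
  let ?a = "0 :: real ^ 'n" and ?b = "(\<chi> j. 2 * pi) :: real ^ 'n"
  have S: "box ?a ?b \<subseteq> ?S" "?S \<subseteq> cbox ?a ?b"
    by (auto simp: mem_box_cart less_imp_le)
  have meas: "?S \<in> sets lborel"
    by measurable
  have "emeasure lborel ?S \<noteq> \<infinity>"
    using emeasure_mono[OF S(2), of lborel] emeasure_lborel_cbox_finite[of ?a ?b] by (auto simp: top_unique)
  moreover have "emeasure lborel ?S \<noteq> 0"
  proof
    assume "emeasure lborel ?S = 0"
    then have "emeasure lborel (box ?a ?b) = 0"
      using emeasure_mono[OF S(1) meas] by simp
    \<comment> \<open>Nonemptiness of the box turns positivity of the coordinates into positivity of
      the inner products with \<open>Basis\<close>, the form used by the volume formula.\<close>
    moreover have "box ?a ?b \<noteq> {}"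
      by (simp add: interval_ne_empty_cart)
    then have pos: "0 < ?b \<bullet> i" if "i \<in> Basis" for i
      using that by (auto simp: box_ne_empty)
    then have "0 < (\<Prod>i\<in>Basis. (?b - ?a) \<bullet> i)"
      by (intro prod_pos) simp
    moreover have "emeasure lborel (box ?a ?b) = ennreal (\<Prod>i\<in>Basis. (?b - ?a) \<bullet> i)"
      using pos by (intro emeasure_lborel_box) (simp add: less_imp_le)
    ultimately show False
      by (simp add: ennreal_eq_0_iff)
  qed
  ultimately show ?thesis
    unfolding torus_def by (intro prob_space_uniform_measure)
qed

lemma sets_torus [measurable_cong, simp]: "sets torus = sets borel"
  by (simp add: torus_def)

lemma space_torus [simp]: "space torus = UNIV"
  by (simp add: torus_def)

lemma norm_character [simp]: "cmod (character \<theta> n) = 1"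
  by (simp add: character_def)

lemma measurable_character [measurable]: "(\<lambda>\<theta>. character \<theta> n) \<in> borel_measurable borel"
  unfolding character_def
  by (intro borel_measurable_continuous_onI continuous_intros)

lemma continuous_phase: "continuous_on UNIV (\<lambda>\<theta>. phase \<theta> u)"
  by (cases u) (auto simp: phase_def intro!: continuous_intros)

lemma measurable_dirichlet_energy [measurable]: "dirichlet_energy w \<in> borel_measurable borel"
  unfolding dirichlet_energy_def
  by (intro borel_measurable_continuous_onI continuous_intros continuous_phase)

text \<open>\<open>Arg\<close> jumps, but the arcsine of half the chord is continuous in
  \<theta>.\<close>

lemma measurable_arc_dist_phase [measurable]:
  "(\<lambda>\<theta>. arc_dist (phase \<theta> u) (phase \<theta> v)) \<in> borel_measurable borel"
proof -
  have "cmod (phase \<theta> u - phase \<theta> v) / 2 \<le> 1" for \<theta>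
    using norm_triangle_ineq4[of "phase \<theta> u" "phase \<theta> v"] by simp
  moreover have "- 1 \<le> cmod z / 2" for z
    by (rule order_trans[of _ 0]) auto
  ultimately have "continuous_on UNIV (\<lambda>\<theta>. 2 * arcsin (cmod (phase \<theta> u - phase \<theta> v) / 2))"
    by (intro continuous_intros continuous_phase) auto
  then show ?thesis
    by (simp add: arc_dist_chord(1) borel_measurable_continuous_onI)
qed

lemma measurable_Lip_phase [measurable]:
  fixes \<delta> :: "'n::finite option \<Rightarrow> 'n option \<Rightarrow> real"
  shows "(\<lambda>\<theta>. Lip \<delta> arc_dist (phase \<theta>)) \<in> borel_measurable borel"
  unfolding Lip_def case_prod_unfold
  by (intro borel_measurable_SUP countable_finite finite) measurable

section \<open>The heat kernel as a torus integral\<close>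

lemma heat_kernel_torus:
  "heat_kernel w t \<alpha> \<beta> =
    (LINT \<theta>|torus. exp (- t * dirichlet_energy w \<theta>) *\<^sub>R character \<theta> (\<alpha> - \<beta>))"
  unfolding heat_kernel_def heat_measure_def
  by (subst integral_density) auto

text \<open>Characters are multiplicative with values on the circle, so the square expands into four
  characters, arranged like the kernel values in \<open>norm_eval_diff_le\<close>.\<close>

lemma norm_character_diff_sq:
  "(cmod (character \<theta> \<alpha> - character \<theta> \<beta>))\<^sup>2 =
    Re (character \<theta> (\<alpha> - \<alpha>) - character \<theta> (\<alpha> - \<beta>) - character \<theta> (\<beta> - \<alpha>) + character \<theta> (\<beta> - \<beta>))"
proof -
  have *: "character \<theta> (\<gamma> - \<eta>) = character \<theta> \<gamma> * cnj (character \<theta> \<eta>)" for \<gamma> \<eta>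
    by (simp add: character_def cis_cnj cis_mult left_diff_distrib sum_subtractf)
  then have "of_real ((cmod (character \<theta> \<alpha> - character \<theta> \<beta>))\<^sup>2) =
      character \<theta> (\<alpha> - \<alpha>) - character \<theta> (\<alpha> - \<beta>) - character \<theta> (\<beta> - \<alpha>) + character \<theta> (\<beta> - \<beta>)"
    unfolding complex_norm_square * by (simp add: algebra_simps)
  then show ?thesis
    by (metis Re_complex_of_real)
qed

text \<open>Nonnegative energy keeps the weight at most 1, and the torus has total mass 1.\<close>

lemma integrable_heat_character:
  fixes w :: "'n::finite option \<Rightarrow> 'n option \<Rightarrow> real"
  assumes "\<And>\<theta>. 0 \<le> dirichlet_energy w \<theta>" "0 < t"
  shows "integrable torus (\<lambda>\<theta>. exp (- t * dirichlet_energy w \<theta>) *\<^sub>R character \<theta> n)"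
proof -
  interpret prob_space "torus :: (real ^ 'n) measure"
    by (rule prob_space_torus)
  show ?thesis
    using assms by (intro integrable_const_bound[of _ 1]) auto
qed

text \<open>Integrating \<open>norm_character_diff_sq\<close> term by term turns the four kernel
  values into the squared heat-weighted L2 norm of a difference of characters.\<close>

lemma heat_kernel_square_diff:
  fixes w :: "'n::finite option \<Rightarrow> 'n option \<Rightarrow> real"
  assumes "\<And>\<theta>. 0 \<le> dirichlet_energy w \<theta>" "0 < t"
  defines "k \<equiv> heat_kernel w t"
    and "F \<equiv> \<lambda>\<theta> \<alpha> \<beta>. exp (- t * dirichlet_energy w \<theta>) * (cmod (character \<theta> \<alpha> - character \<theta> \<beta>))\<^sup>2"
  shows "integrable torus (\<lambda>\<theta>. F \<theta> \<alpha> \<beta>)"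
    and "Re (k \<alpha> \<alpha> - k \<alpha> \<beta> - k \<beta> \<alpha> + k \<beta> \<beta>) = (LINT \<theta>|torus. F \<theta> \<alpha> \<beta>)"
proof -
  let ?c = "\<lambda>n \<theta>. exp (- t * dirichlet_energy w \<theta>) *\<^sub>R character \<theta> n"
  note int = integrable_heat_character[OF assms(1,2)]
  have F: "F \<theta> \<alpha> \<beta> = Re (?c (\<alpha> - \<alpha>) \<theta> - ?c (\<alpha> - \<beta>) \<theta> - ?c (\<beta> - \<alpha>) \<theta> + ?c (\<beta> - \<beta>) \<theta>)" for \<theta>
    unfolding F_def norm_character_diff_sq by (simp add: algebra_simps)
  show "integrable torus (\<lambda>\<theta>. F \<theta> \<alpha> \<beta>)"
    unfolding F by (intro integrable_Re Bochner_Integration.integrable_add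
        Bochner_Integration.integrable_diff int)
  show "Re (k \<alpha> \<alpha> - k \<alpha> \<beta> - k \<beta> \<alpha> + k \<beta> \<beta>) = (LINT \<theta>|torus. F \<theta> \<alpha> \<beta>)"
    unfolding F k_def heat_kernel_torus
    by (simp only: integral_Re Bochner_Integration.integral_add Bochner_Integration.integral_diff
        Bochner_Integration.integrable_add Bochner_Integration.integrable_diff int)
qed

text \<open>Apply s \<le> exp s to s = c y^2. The bound is uniform in y and yields integrability of
  the final integrand.\<close>

lemma square_mult_exp_le:
  fixes c y :: real
  assumes "0 < c"
  shows "y\<^sup>2 * exp (- c * y\<^sup>2) \<le> 1 / c"
proof -
  have "c * y\<^sup>2 \<le> exp (c * y\<^sup>2)"
    using exp_ge_add_one_self[of "c * y\<^sup>2"] by linarith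
  then show ?thesis
    using assms by (simp add: exp_minus field_simps)
qed

section \<open>Lipschitz bound for functions in the heat space\<close>

theorem corollary1p4:
  fixes A :: "'a::metric_space set"
    and x :: "'n::finite \<Rightarrow> 'a"
    and E :: "'n option \<Rightarrow> 'n option \<Rightarrow> bool"
    and w :: "'n option \<Rightarrow> 'n option \<Rightarrow> real"
    and t :: real
    and H :: "(int ^ 'n \<Rightarrow> complex) set"
    and ip :: "(int ^ 'n \<Rightarrow> complex) \<Rightarrow> (int ^ 'n \<Rightarrow> complex) \<Rightarrow> complex"
    and f :: "int ^ 'n \<Rightarrow> complex"
  assumes "A \<noteq> {}"
    and "inj x" and "range x = - A"
    and "Metric_space UNIV (d1bar A x)"
    and "connected_simple_graph E"
    and "\<forall>u v. path_metric E (d1bar A x) u v = d1bar A x u v"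
    and "conductances E w"
    and "t > 0"
    and "rkhs (heat_kernel w t) H ip"
    and "f \<in> H"
  shows "Lip (rho (d1bar A x)) dist f \<le>
    ennreal (ip_norm ip f *
      sqrt (LINT \<theta>|torus.
        (enn2real (Lip (d1bar A x) arc_dist (phase \<theta>)))\<^sup>2 *
        exp (- t * (4 * edge_min E w * (edge_min E (d1bar A x))\<^sup>2 / pi\<^sup>2) *
          (enn2real (Lip (d1bar A x) arc_dist (phase \<theta>)))\<^sup>2)))"
proof -
  define \<delta> where "\<delta> = d1bar A x"
  define L where "L = (\<lambda>\<theta> :: real ^ 'n. enn2real (Lip \<delta> arc_dist (phase \<theta>)))"
  define \<kappa> where "\<kappa> = 4 * edge_min E w * (edge_min E \<delta>)\<^sup>2 / pi\<^sup>2"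
  define I where "I = (LINT \<theta>|torus. (L \<theta>)\<^sup>2 * exp (- t * \<kappa> * (L \<theta>)\<^sup>2))"
  define R where "R = (\<lambda>a b. rho \<delta> a b)"
  interpret Metric_space UNIV \<delta>
    using assms(4) by (simp add: \<delta>_def)
  interpret rkhs "heat_kernel w t" H ip by fact
  interpret T: prob_space "torus :: (real ^ 'n) measure"
    by (rule prob_space_torus)
  have M: "Metric_space UNIV \<delta>" ..
  obtain a b where "E a b"
    using connected_simple_graph_has_edge[OF assms(5) option.distinct(1)[of undefined]] by blast
  moreover have "0 < w u v" "0 < \<delta> u v" if "E u v" for u v
    using that assms(5,7) by (auto simp: conductances_def connected_simple_graph_def irreflp_def)
  ultimately have \<kappa>: "0 < \<kappa>"
    using edge_min_pos[of E a b] unfolding \<kappa>_def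
    by (intro divide_pos_pos mult_pos_pos zero_less_power) auto
  have energy: "\<kappa> * (L \<theta>)\<^sup>2 \<le> dirichlet_energy w \<theta>" for \<theta>
    using dirichlet_energy_ge_Lip[OF M assms(5) _ assms(7), of \<theta>] assms(6)
    unfolding \<kappa>_def L_def \<delta>_def by blast
  \<comment> \<open>The lower bound already contains nonnegativity of the energy, which
    integrability of the weighted characters rests on.\<close>
  then have energy0: "0 \<le> dirichlet_energy w \<theta>" for \<theta>
    using \<kappa> by (meson order_trans mult_nonneg_nonneg less_imp_le zero_le_power2)
  have [measurable]: "L \<in> borel_measurable borel"
    unfolding L_def by measurable
  \<comment> \<open>A nonintegrable function would have Bochner integral 0 by default, and the
    comparison of integrals would break down.\<close>
  have int: "integrable torus (\<lambda>\<theta>. (L \<theta>)\<^sup>2 * exp (- t * \<kappa> * (L \<theta>)\<^sup>2))"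
    using \<open>0 < t\<close> \<kappa> square_mult_exp_le[of "t * \<kappa>"]
    by (intro T.integrable_const_bound[of _ "1 / (t * \<kappa>)"]) auto
  have bound: "cmod (f \<alpha> - f \<beta>) \<le> ip_norm ip f * sqrt I * R \<alpha> \<beta>" for \<alpha> \<beta>
  proof -
    have R0: "0 \<le> R \<alpha> \<beta>"
      unfolding R_def rho_def by (rule W1_nonneg[OF M])
    let ?F = "\<lambda>\<theta>. exp (- t * dirichlet_energy w \<theta>) * (cmod (character \<theta> \<alpha> - character \<theta> \<beta>))\<^sup>2"
    \<comment> \<open>Pointwise, the Lipschitz bound for characters is multiplied by the bound on
      the heat weight; \<open>R \<alpha> \<beta>\<close> is free of \<theta> and leaves the
      integral.\<close>
    have "(LINT \<theta>|torus. ?F \<theta>) \<le>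
        (LINT \<theta>|torus. (R \<alpha> \<beta>)\<^sup>2 * ((L \<theta>)\<^sup>2 * exp (- t * \<kappa> * (L \<theta>)\<^sup>2)))"
    proof (rule integral_mono)
      fix \<theta> :: "real ^ 'n"
      have "(cmod (character \<theta> \<alpha> - character \<theta> \<beta>))\<^sup>2 \<le> (L \<theta> * R \<alpha> \<beta>)\<^sup>2"
        unfolding L_def R_def by (intro power_mono character_lipschitz M) auto
      moreover have "exp (- t * dirichlet_energy w \<theta>) \<le> exp (- t * \<kappa> * (L \<theta>)\<^sup>2)"
        using mult_left_mono[OF energy, of t \<theta>] \<open>0 < t\<close> by (simp add: algebra_simps)
      ultimately have "?F \<theta> \<le> exp (- t * \<kappa> * (L \<theta>)\<^sup>2) * (L \<theta> * R \<alpha> \<beta>)\<^sup>2"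
        by (intro mult_mono) auto
      then show "?F \<theta> \<le> (R \<alpha> \<beta>)\<^sup>2 * ((L \<theta>)\<^sup>2 * exp (- t * \<kappa> * (L \<theta>)\<^sup>2))"
        by (simp add: power_mult_distrib algebra_simps)
    qed (use int heat_kernel_square_diff(1)[OF energy0 \<open>0 < t\<close>] in simp_all)
    also have "\<dots> = (R \<alpha> \<beta>)\<^sup>2 * I"
      by (simp add: I_def)
    finally have "sqrt (LINT \<theta>|torus. ?F \<theta>) \<le> R \<alpha> \<beta> * sqrt I"
      using R0 real_sqrt_le_mono by (fastforce simp: real_sqrt_mult)
    then have "ip_norm ip f * sqrt (LINT \<theta>|torus. ?F \<theta>) \<le> ip_norm ip f * (R \<alpha> \<beta> * sqrt I)"
      by (rule mult_left_mono) (simp add: ip_norm_def ip_nonneg \<open>f \<in> H\<close>)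
    then show ?thesis
      using norm_eval_diff_le[OF \<open>f \<in> H\<close>, of \<alpha> \<beta>]
      unfolding heat_kernel_square_diff(2)[OF energy0 \<open>0 < t\<close>] by (simp add: algebra_simps)
  qed
  have "0 \<le> I"
    unfolding I_def by (rule integral_nonneg_AE) simp
  then have C0: "0 \<le> ip_norm ip f * sqrt I"
    by (simp add: ip_norm_def ip_nonneg \<open>f \<in> H\<close>)
  have "Lip R dist f \<le> ennreal (ip_norm ip f * sqrt I)"
  proof (rule Lip_leI)
    fix \<alpha> \<beta>
    have "0 \<le> R \<alpha> \<beta>"
      unfolding R_def rho_def by (rule W1_nonneg[OF M])
    \<comment> \<open>If \<open>R \<alpha> \<beta> = 0\<close>, the quotient is 0 by convention and
      nonnegativity of the constant suffices.\<close>
    then show "dist (f \<alpha>) (f \<beta>) / R \<alpha> \<beta> \<le> ip_norm ip f * sqrt I"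
      using bound[of \<alpha> \<beta>] C0 by (cases "R \<alpha> \<beta> = 0") (auto simp: dist_norm pos_divide_le_eq)
  qed
  then show ?thesis
    by (simp add: R_def I_def L_def \<kappa>_def \<delta>_def)
qed

end
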